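(* Let $G$ be a finite connected undirected loopless multigraph with vertices $v_0,\dots,v_n$ and sink $v_0$, and let $H$ be a hereditary chip-firing model on $G$. Then there exists a unique recurrent configuration $\nu$ in each chip-firing equivalence class.
   Context: A configuration is a function $D:V(G)\to\mathbb Z$ of degree $0$, i.e. $\sum_{i=0}^n D(v_i)=0$; by convention the configurations considered also satisfy $D(v_i)\ge0$ for $i\ne0$, although intermediate stages of firing may be negative anywhere. $Q$ is the Laplacian of $G$ (diagonal degree matrix minus adjacency matrix), $\chi_S$ is the characteristic vector of $S\subset V(G)$, and $\chi_i=\chi_{\{v_i\}}$. Firing a set $S$ replaces $D$ by $D-Q\chi_S$. A vertex $v$ is in debt in $D$ if $D(v)<0$. Two configurations are equivalent if some sequence of firings takes one to the other (possibly including firings of $v_0$ and passing through configurations negative at vertices other than $v_0$), equivalently if their difference lies in the integral span of the columns of $Q$; the classes are called chip-firing equivalence classes. A hereditary chip-firing model is a collection $H$ of subsets of $V(G)\setminus\{v_0\}$ such that every $v_i$ with $i\ne0$ lies in some member of $H$, and $B\subset A\in H$ implies $B\in H$. A nonempty set $M\in H$ is ready in $D$ if it can fire without any $v\in M$ being sent into debt, i.e. $(D-Q\chi_M)(v)\ge0$ for all $v\in M$. $D$ is stable if no nonempty $M\in H$ is ready in $D$. $D$ is reachable from $D'$ if one can add chips to $D'$ (that is, add a sum of configurations $\chi_i-\chi_0$, $i\ne0$) and then successively fire ready sets of $H$ so as to obtain $D$. $D$ is globally reachable if it is reachable from every other configuration. $D$ is recurrent if it is both stable and globally reachable. *)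

theory Defs
  imports "HOL-Analysis.Cartesian_Space" "HOL-Library.Multiset"
begin

text \<open>
  The vertex set is a finite type; one of its elements is designated as the sink.
  A multigraph is the multiset of its edges, an edge being the set of its two end points,
  so that \<open>count E {u, v}\<close> is the number of edges between \<open>u\<close> and \<open>v\<close>.
\<close>

definition loopless_multigraph :: "'v set multiset \<Rightarrow> bool" where
  "loopless_multigraph E \<longleftrightarrow> (\<forall>e\<in>#E. card e = 2)"

definition connected_multigraph :: "'v set multiset \<Rightarrow> bool" where
  "connected_multigraph E \<longleftrightarrow> (\<forall>u v. (\<lambda>x y. {x, y} \<in># E)\<^sup>*\<^sup>* u v)"

definition vertex_degree :: "'v set multiset \<Rightarrow> 'v \<Rightarrow> nat" where
  "vertex_degree E v = size {#e \<in># E. v \<in> e#}"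

definition adjacency_matrix :: "'v::finite set multiset \<Rightarrow> int ^ 'v ^ 'v" where
  "adjacency_matrix E = (\<chi> u v. int (count E {u, v}))"

definition degree_matrix :: "'v::finite set multiset \<Rightarrow> int ^ 'v ^ 'v" where
  "degree_matrix E = (\<chi> u v. if u = v then int (vertex_degree E u) else 0)"

definition laplacian :: "'v::finite set multiset \<Rightarrow> int ^ 'v ^ 'v" where
  "laplacian E = degree_matrix E - adjacency_matrix E"

definition char_vec :: "'v::finite set \<Rightarrow> int ^ 'v" where
  "char_vec S = (\<chi> v. if v \<in> S then 1 else 0)"

definition fire :: "'v::finite set multiset \<Rightarrow> 'v set \<Rightarrow> int ^ 'v \<Rightarrow> int ^ 'v" where
  "fire E S D = D - laplacian E *v char_vec S"

definition degree_zero :: "int ^ 'v::finite \<Rightarrow> bool" where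
  "degree_zero D \<longleftrightarrow> (\<Sum>v\<in>UNIV. D $ v) = 0"

definition configuration :: "'v::finite \<Rightarrow> int ^ 'v \<Rightarrow> bool" where
  "configuration s D \<longleftrightarrow> degree_zero D \<and> (\<forall>v. v \<noteq> s \<longrightarrow> D $ v \<ge> 0)"

text \<open>
  Equivalence allows firing arbitrary sets, the sink included, with no condition on debt.
  It is taken on all vectors of degree 0, so that the classes are the cosets of the
  integral span of the columns of the Laplacian, as shown below.
\<close>

definition firing_equiv :: "'v::finite set multiset \<Rightarrow> ((int ^ 'v) \<times> (int ^ 'v)) set" where
  "firing_equiv E = {(D, D'). degree_zero D \<and> degree_zero D' \<and>
     (\<lambda>X Y. \<exists>S. Y = fire E S X)\<^sup>*\<^sup>* D D'}"

definition firing_classes :: "'v::finite set multiset \<Rightarrow> (int ^ 'v) set set" where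
  "firing_classes E = {D. degree_zero D} // firing_equiv E"

definition hereditary_model :: "'v \<Rightarrow> 'v set set \<Rightarrow> bool" where
  "hereditary_model s H \<longleftrightarrow>
     (\<forall>A\<in>H. s \<notin> A) \<and> (\<forall>v. v \<noteq> s \<longrightarrow> (\<exists>A\<in>H. v \<in> A)) \<and> (\<forall>A\<in>H. \<forall>B. B \<subseteq> A \<longrightarrow> B \<in> H)"

definition ready :: "'v::finite set multiset \<Rightarrow> 'v set set \<Rightarrow> int ^ 'v \<Rightarrow> 'v set \<Rightarrow> bool" where
  "ready E H D M \<longleftrightarrow> M \<in> H \<and> M \<noteq> {} \<and> (\<forall>v\<in>M. fire E M D $ v \<ge> 0)"

definition stable :: "'v::finite set multiset \<Rightarrow> 'v set set \<Rightarrow> int ^ 'v \<Rightarrow> bool" where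
  "stable E H D \<longleftrightarrow> \<not> (\<exists>M. ready E H D M)"

definition add_chips :: "'v::finite \<Rightarrow> ('v \<Rightarrow> nat) \<Rightarrow> int ^ 'v \<Rightarrow> int ^ 'v" where
  "add_chips s c D = D + (\<Sum>i\<in>UNIV - {s}. int (c i) *s (char_vec {i} - char_vec {s}))"

definition reachable ::
  "'v::finite set multiset \<Rightarrow> 'v \<Rightarrow> 'v set set \<Rightarrow> int ^ 'v \<Rightarrow> int ^ 'v \<Rightarrow> bool" where
  "reachable E s H D' D \<longleftrightarrow>
     (\<exists>c. (\<lambda>X Y. \<exists>M. ready E H X M \<and> Y = fire E M X)\<^sup>*\<^sup>* (add_chips s c D') D)"

definition globally_reachable ::
  "'v::finite set multiset \<Rightarrow> 'v \<Rightarrow> 'v set set \<Rightarrow> int ^ 'v \<Rightarrow> bool" where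
  "globally_reachable E s H D \<longleftrightarrow>
     (\<forall>D'. configuration s D' \<and> D' \<noteq> D \<longrightarrow> reachable E s H D' D)"

definition recurrent ::
  "'v::finite set multiset \<Rightarrow> 'v \<Rightarrow> 'v set set \<Rightarrow> int ^ 'v \<Rightarrow> bool" where
  "recurrent E s H D \<longleftrightarrow> configuration s D \<and> stable E H D \<and> globally_reachable E s H D"

lemma fires_imp_span:
  assumes "(\<lambda>X Y. \<exists>S. Y = fire E S X)\<^sup>*\<^sup>* D D'"
  shows "\<exists>x. D' = D - laplacian E *v x"
  using assms
proof (induction rule: rtranclp_induct)
  case base
  show ?case by (rule exI[of _ 0]) simp
next
  case (step Y Z)
  then obtain x S where "Y = D - laplacian E *v x" "Z = fire E S Y" by blast
  then have "Z = D - laplacian E *v (x + char_vec S)"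
    by (simp add: fire_def matrix_vector_right_distrib diff_diff_eq)
  then show ?case by blast
qed

lemma vertex_degree_eq_sum:
  fixes E :: "'v::finite set multiset"
  assumes "loopless_multigraph E"
  shows "vertex_degree E u = (\<Sum>v\<in>UNIV. count E {u, v})"
  using assms
proof (induction E)
  case empty
  show ?case by (simp add: vertex_degree_def)
next
  case (add e E)
  from add.prems have e: "card e = 2" and E: "loopless_multigraph E"
    by (auto simp: loopless_multigraph_def)
  have "(\<Sum>v\<in>UNIV. if e = {u, v} then 1 else 0) = (if u \<in> e then 1 else 0 :: nat)"
  proof (cases "u \<in> e")
    case True
    with e obtain w where w: "e = {u, w}" "u \<noteq> w"
      by (auto simp: card_2_iff)
    then have "(e = {u, v}) = (w = v)" for v by (auto simp: doubleton_eq_iff)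
    then show ?thesis using True by simp
  next
    case False
    then have "e \<noteq> {u, v}" for v by auto
    then show ?thesis using False by simp
  qed
  moreover have "count (add_mset e E) {u, v} = (if e = {u, v} then 1 else 0) + count E {u, v}" for v
    by auto
  ultimately show ?case
    using add.IH[OF E] by (simp add: vertex_degree_def sum.distrib del: count_add_mset)
qed

lemma laplacian_char_vec_UNIV:
  assumes "loopless_multigraph E"
  shows "laplacian E *v char_vec UNIV = 0"
  using vertex_degree_eq_sum[OF assms]
  by (simp add: vec_eq_iff laplacian_def degree_matrix_def adjacency_matrix_def char_vec_def
      matrix_vector_mult_def sum_subtractf)

lemma firing_equiv_iff_span:
  assumes "loopless_multigraph E"
  shows "(D, D') \<in> firing_equiv E \<longleftrightarrow>
    degree_zero D \<and> degree_zero D' \<and> (\<exists>x. D - D' = laplacian E *v x)"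
proof -
  let ?R = "\<lambda>X Y. \<exists>S. Y = fire E S X"
  have single: "?R\<^sup>*\<^sup>* X (X - laplacian E *v (int k *s char_vec S))" for X k S
  proof (induction k)
    case 0
    show ?case by simp
  next
    case (Suc k)
    have "X - laplacian E *v (int (Suc k) *s char_vec S)
        = fire E S (X - laplacian E *v (int k *s char_vec S))"
      by (simp add: fire_def matrix_vector_right_distrib algebra_simps vector_sadd_rdistrib)
    then show ?case using Suc by (metis (mono_tags, lifting) rtranclp.rtrancl_into_rtrancl)
  qed
  have multi: "?R\<^sup>*\<^sup>* X (X - laplacian E *v (\<Sum>i\<in>A. int (k i) *s char_vec {i}))"
    if "finite A" for X k A
    using that
  proof (induction A)
    case empty
    show ?case by simp
  next
    case (insert a A)
    have "X - laplacian E *v (\<Sum>i\<in>insert a A. int (k i) *s char_vec {i})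
       = (X - laplacian E *v (\<Sum>i\<in>A. int (k i) *s char_vec {i}))
           - laplacian E *v (int (k a) *s char_vec {a})"
      using insert by (simp add: matrix_vector_right_distrib algebra_simps)
    then show ?case using insert single by (metis (mono_tags, lifting) rtranclp_trans)
  qed
  have "?R\<^sup>*\<^sup>* D (D - laplacian E *v x)" for x
  proof -
    define m where "m = (\<Sum>i\<in>UNIV. \<bar>x $ i\<bar>)"
    have m: "\<bar>x $ i\<bar> \<le> m" for i
      unfolding m_def by (rule member_le_sum) auto
    have "(\<Sum>i\<in>UNIV. int (nat (x $ i + m)) *s char_vec {i}) = x + m *s char_vec UNIV"
    proof -
      have "0 \<le> x $ i + m" for i using m[of i] by linarith
      then show ?thesis
        by (simp add: vec_eq_iff char_vec_def sum.delta if_distrib cong: if_cong)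
    qed
    moreover have "laplacian E *v (x + m *s char_vec UNIV) = laplacian E *v x"
    proof -
      have "laplacian E *v (m *s char_vec UNIV) = m *s (laplacian E *v char_vec UNIV)"
        by (simp add: vec_eq_iff matrix_vector_mult_def sum_distrib_left mult_ac)
      then show ?thesis
        using laplacian_char_vec_UNIV[OF assms] by (simp add: matrix_vector_right_distrib)
    qed
    ultimately show ?thesis using multi[of UNIV D "\<lambda>i. nat (x $ i + m)"] by simp
  qed
  moreover have "D - D' = laplacian E *v x \<longleftrightarrow> D' = D - laplacian E *v x" for x
    by (auto simp: algebra_simps)
  ultimately show ?thesis
    unfolding firing_equiv_def using fires_imp_span[of E D D'] by auto
qed

lemma equiv_firing_equiv:
  assumes "loopless_multigraph E"
  shows "equiv {D. degree_zero D} (firing_equiv E)"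
proof (rule equivI)
  show "firing_equiv E \<subseteq> {D. degree_zero D} \<times> {D. degree_zero D}"
    by (auto simp: firing_equiv_def)
  show "refl_on {D. degree_zero D} (firing_equiv E)"
    by (auto simp: refl_on_def firing_equiv_def)
  show "trans (firing_equiv E)"
    by (auto simp: trans_def firing_equiv_def intro: rtranclp_trans)
  have neg: "\<exists>y. D' - D = laplacian E *v y" if "D - D' = laplacian E *v x" for D D' x
  proof
    have "laplacian E *v (- x) = - (laplacian E *v x)"
      by (simp add: vec_eq_iff matrix_vector_mult_def sum_negf)
    then show "D' - D = laplacian E *v (- x)" using that by (metis minus_diff_eq)
  qed
  show "sym (firing_equiv E)"
    using neg by (auto simp: sym_def firing_equiv_iff_span[OF assms])
qed

end

theory Submission
  imports Defs "HOL-Library.Confluence"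
begin

text \<open>
  If \<open>A\<close> and \<open>B\<close> are both ready, then \<open>B - A\<close> is ready once \<open>A\<close> has fired, so firing ready sets
  is confluent; it terminates because a cycle of firings would give a nonzero nonnegative vector in
  the kernel of the Laplacian that vanishes at the sink. Hence stabilizations exist and are unique.
  Subtracting from a large configuration its stabilization yields arbitrarily large
  configurations \<open>e\<close> in the image of the Laplacian such that \<open>\<nu> + e\<close> stabilizes to \<open>\<nu>\<close> for every
  recurrent \<open>\<nu>\<close>. If \<open>\<nu>\<close> and \<open>\<nu>'\<close> are recurrent and equivalent and \<open>e\<close> is large, then \<open>\<nu> + e\<close> and
  \<open>\<nu>' + e\<close> can legally be fired to a common configuration, whence \<open>\<nu> = \<nu>'\<close>. Conversely, the
  stabilization of any large configuration of a class is recurrent.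
\<close>

section \<open>The Laplacian\<close>

lemma laplacian_mult_nth:
  "(laplacian E *v x) $ v =
    int (vertex_degree E v) * x $ v - (\<Sum>u\<in>UNIV. int (count E {v, u}) * x $ u)"
proof -
  have "(if v = u then int (vertex_degree E v) else 0) * x $ u =
      (if v = u then int (vertex_degree E v) * x $ u else 0)" for u
    by simp
  then show ?thesis
    by (simp add: laplacian_def degree_matrix_def adjacency_matrix_def matrix_vector_mult_def
        left_diff_distrib sum_subtractf sum.delta)
qed

text \<open>The columns of the Laplacian sum to zero, since the adjacency matrix is symmetric and
  its row sums are the degrees. Hence firing preserves degree zero.\<close>

lemma sum_laplacian_mult:
  assumes "loopless_multigraph E"
  shows "(\<Sum>v\<in>UNIV. (laplacian E *v x) $ v) = 0"
proof -
  have "(\<Sum>v\<in>UNIV. \<Sum>u\<in>UNIV. int (count E {v, u}) * x $ u) =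
      (\<Sum>u\<in>UNIV. \<Sum>v\<in>UNIV. int (count E {u, v}) * x $ u)"
    by (subst sum.swap) (simp add: insert_commute)
  also have "\<dots> = (\<Sum>u\<in>UNIV. int (vertex_degree E u) * x $ u)"
    by (simp add: vertex_degree_eq_sum[OF assms] sum_distrib_right)
  finally show ?thesis
    by (simp add: laplacian_mult_nth sum_subtractf)
qed

lemma degree_zero_diff_laplacian:
  assumes "loopless_multigraph E"
  shows "degree_zero (D - laplacian E *v x) \<longleftrightarrow> degree_zero D"
  using sum_laplacian_mult[OF assms] by (simp add: degree_zero_def sum_subtractf)

text \<open>Where \<open>x\<close> vanishes, the kernel equation makes a weighted sum of its
  nonnegative values at the neighbours zero, so \<open>x\<close> vanishes there too. Connectivity
  spreads the zero from \<open>s\<close> to every vertex.\<close>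

lemma laplacian_kernel_nonneg_eq_0:
  assumes "connected_multigraph E" "laplacian E *v x = 0" "\<And>v. x $ v \<ge> 0" "x $ s = 0"
  shows "x = 0"
proof -
  have step: "x $ w = 0" if "x $ u = 0" "{u, w} \<in># E" for u w
  proof -
    have "(\<Sum>w\<in>UNIV. int (count E {u, w}) * x $ w) = 0"
      using laplacian_mult_nth[of E x u] that(1) assms(2) by simp
    then have "int (count E {u, w}) * x $ w = 0"
      using assms(3) by (subst (asm) sum_nonneg_eq_0_iff) auto
    moreover have "count E {u, w} \<noteq> 0" using that(2) by (simp only: count_eq_zero_iff not_not)
    ultimately show ?thesis by simp
  qed
  have "x $ v = 0" for v
  proof -
    have "(\<lambda>x y. {x, y} \<in># E)\<^sup>*\<^sup>* s v"
      using assms(1) by (simp add: connected_multigraph_def)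
    then show ?thesis
      by (induction rule: rtranclp_induct) (use assms(4) step in auto)
  qed
  then show ?thesis by (simp add: vec_eq_iff)
qed

section \<open>Firing a set and the arithmetic of configurations\<close>

lemma fire_nth:
  "fire E M D $ v =
    D $ v - (if v \<in> M then int (vertex_degree E v) else 0) + (\<Sum>u\<in>M. int (count E {v, u}))"
proof -
  have "(\<Sum>u\<in>UNIV. int (count E {v, u}) * char_vec M $ u) =
      (\<Sum>u\<in>UNIV. if u \<in> M then int (count E {v, u}) else 0)"
    by (rule sum.cong) (auto simp: char_vec_def)
  also have "\<dots> = (\<Sum>u\<in>M. int (count E {v, u}))"
    by (simp add: sum.If_cases)
  finally show ?thesis
    by (simp add: fire_def laplacian_mult_nth) (simp add: char_vec_def)
qed

lemma fire_disjoint_Un: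
  assumes "A \<inter> B = {}"
  shows "fire E B (fire E A D) = fire E (A \<union> B) D"
proof -
  have "char_vec (A \<union> B) = char_vec A + char_vec B"
    using assms by (auto simp: vec_eq_iff char_vec_def)
  then show ?thesis by (simp add: fire_def matrix_vector_right_distrib)
qed

lemma fire_add: "fire E M (D + c) = fire E M D + c"
  by (simp add: fire_def)

lemma fire_nth_ge: "v \<notin> M \<Longrightarrow> D $ v \<le> fire E M D $ v"
  by (simp add: fire_nth sum_nonneg)

lemma configuration_add:
  "configuration s D \<Longrightarrow> configuration s c \<Longrightarrow> configuration s (D + c)"
  by (simp add: configuration_def degree_zero_def sum.distrib)

lemma configuration_diff:
  assumes "configuration s D" "configuration s c" "\<And>v. v \<noteq> s \<Longrightarrow> c $ v \<le> D $ v"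
  shows "configuration s (D - c)"
  using assms by (simp add: configuration_def degree_zero_def sum_subtractf)

text \<open>The sink may be negative, so it can balance any nonnegative values prescribed elsewhere.
  This supplies the large configurations needed later.\<close>

lemma ex_configuration:
  fixes g :: "'v::finite \<Rightarrow> int"
  assumes "\<And>v. v \<noteq> s \<Longrightarrow> g v \<ge> 0"
  shows "\<exists>K. configuration s K \<and> (\<forall>v. v \<noteq> s \<longrightarrow> K $ v = g v)"
proof -
  let ?K = "\<chi> v. if v = s then - sum g (UNIV - {s}) else g v"
  have "(\<Sum>v\<in>UNIV. ?K $ v) = ?K $ s + (\<Sum>v\<in>UNIV - {s}. ?K $ v)"
    by (rule sum.remove) auto
  also have "\<dots> = 0" by simp
  finally show ?thesis
    using assms by (intro exI[of _ ?K]) (simp add: configuration_def degree_zero_def)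
qed

text \<open>The vectors that can be added are exactly the configurations: off the sink their entries
  are arbitrary naturals, and degree zero fixes the entry at \<open>s\<close>. Adding chips can thus
  be treated as vector addition.\<close>

lemma ex_add_chips_iff:
  "(\<exists>c. P (add_chips s c D)) \<longleftrightarrow> (\<exists>c. configuration s c \<and> P (D + c))"
proof -
  define a where "a c = (\<Sum>i\<in>UNIV - {s}. int (c i) *s (char_vec {i} - char_vec {s}))" for c
  have off: "a c $ v = int (c v)" if "v \<noteq> s" for c v
  proof -
    have "a c $ v = (\<Sum>i\<in>UNIV - {s}. if i = v then int (c i) else 0)"
      unfolding a_def sum_component using that
      by (intro sum.cong) (auto simp: char_vec_def)
    then show ?thesis using that by (simp add: sum.delta)
  qed
  have at: "a c $ s = - (\<Sum>i\<in>UNIV - {s}. int (c i))" for c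
    unfolding a_def sum_component sum_negf[symmetric]
    by (intro sum.cong) (auto simp: char_vec_def)
  have split: "(\<Sum>v\<in>UNIV. x $ v) = x $ s + (\<Sum>v\<in>UNIV - {s}. x $ v)" for x :: "int ^ 'a"
    by (rule sum.remove) auto
  have conf: "configuration s (a c)" for c
    by (simp add: configuration_def degree_zero_def split at off)
  have "\<exists>d. c = a d" if "configuration s c" for c
  proof
    have "c $ s = - (\<Sum>v\<in>UNIV - {s}. c $ v)"
      using that split[of c] by (simp add: configuration_def degree_zero_def)
    moreover have "int (nat (c $ v)) = c $ v" if "v \<noteq> s" for v
      using \<open>configuration s c\<close> that by (simp add: configuration_def)
    ultimately have "c $ v = a (\<lambda>v. nat (c $ v)) $ v" for v
      by (cases "v = s") (simp_all add: at off del: int_nat_eq)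
    then show "c = a (\<lambda>v. nat (c $ v))" unfolding vec_eq_iff by blast
  qed
  then have "configuration s c \<longleftrightarrow> (\<exists>d. c = a d)" for c using conf by blast
  moreover have "add_chips s d D = D + a d" for d by (simp only: add_chips_def a_def)
  ultimately show ?thesis by metis
qed

section \<open>Firing ready sets\<close>

locale hereditary_chip_firing =
  fixes E :: "'v::finite set multiset" and s :: 'v and H :: "'v set set"
  assumes loopless: "loopless_multigraph E" and connected: "connected_multigraph E"
    and hereditary: "hereditary_model s H"
begin

definition step :: "int ^ 'v \<Rightarrow> int ^ 'v \<Rightarrow> bool" where
  "step X Y \<longleftrightarrow> (\<exists>M. ready E H X M \<and> Y = fire E M X)"

abbreviation steps :: "int ^ 'v \<Rightarrow> int ^ 'v \<Rightarrow> bool" where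
  "steps \<equiv> step\<^sup>*\<^sup>*"

lemma sink_notin_ready: "ready E H X M \<Longrightarrow> s \<notin> M"
  using hereditary by (auto simp: hereditary_model_def ready_def)

lemma subset_in_H: "A \<in> H \<Longrightarrow> B \<subseteq> A \<Longrightarrow> B \<in> H"
  using hereditary unfolding hereditary_model_def by blast

lemma singleton_in_H: "v \<noteq> s \<Longrightarrow> {v} \<in> H"
proof -
  assume "v \<noteq> s"
  then obtain A where "A \<in> H" "v \<in> A"
    using hereditary by (auto simp: hereditary_model_def)
  then show "{v} \<in> H" using subset_in_H[of A "{v}"] by simp
qed

lemma reachable_iff:
  "reachable E s H D' D \<longleftrightarrow> (\<exists>c. configuration s c \<and> steps (D' + c) D)"
proof -
  have "step = (\<lambda>X Y. \<exists>M. ready E H X M \<and> Y = fire E M X)"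
    by (auto simp: fun_eq_iff step_def)
  then show ?thesis
    unfolding reachable_def using ex_add_chips_iff[of "\<lambda>X. steps X D"] by simp
qed

lemma stable_iff: "stable E H X \<longleftrightarrow> (\<forall>Y. \<not> step X Y)"
  by (auto simp: stable_def step_def)

lemma stable_steps: "steps X Y \<Longrightarrow> stable E H X \<Longrightarrow> Y = X"
  by (erule converse_rtranclpE) (auto simp: stable_iff)

section \<open>Confluence of firing\<close>

text \<open>Firing \<open>A \<union> B\<close> amounts to firing \<open>B\<close> and then
  \<open>A - B\<close>. A vertex of \<open>B - A\<close> is out of debt after the first stage and
  only gains chips in the second. Heredity makes \<open>B - A\<close> a member of
  \<open>H\<close>.\<close>

lemma ready_after_fire:
  assumes A: "ready E H X A" and B: "ready E H X B" and ne: "\<not> B \<subseteq> A"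
  shows "step (fire E A X) (fire E (A \<union> B) X)"
proof -
  have "fire E (A \<union> B) X $ v \<ge> 0" if "v \<in> B" "v \<notin> A" for v
  proof -
    have "fire E (A \<union> B) X = fire E (A - B) (fire E B X)"
      by (subst fire_disjoint_Un) (auto simp: Un_commute)
    then have "fire E B X $ v \<le> fire E (A \<union> B) X $ v"
      using that by (simp add: fire_nth_ge)
    then show ?thesis using B that by (fastforce simp: ready_def)
  qed
  moreover have "fire E (B - A) (fire E A X) = fire E (A \<union> B) X"
    by (subst fire_disjoint_Un) auto
  moreover have "B - A \<in> H" using B subset_in_H by (auto simp: ready_def)
  ultimately show ?thesis
    unfolding step_def ready_def using ne by (intro exI[of _ "B - A"]) auto
qed

lemma confluent_step: "confluentp step"
proof (intro strong_confluentp_imp_confluentp strong_confluentpI)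
  \<comment> \<open>The reflexive closure covers the case in which \<open>A\<close> contains
    \<open>B\<close> and nothing is left to fire.\<close>
  have one: "step\<^sup>=\<^sup>= (fire E A X) (fire E (A \<union> B) X)"
    if "ready E H X A" "ready E H X B" for X A B
    using ready_after_fire[OF that] by (cases "B \<subseteq> A") (auto simp: Un_absorb2)
  fix X Y Z assume "step X Y" "step X Z"
  then obtain A B where AB: "ready E H X A" "Y = fire E A X" "ready E H X B" "Z = fire E B X"
    by (auto simp: step_def)
  then have "step\<^sup>=\<^sup>= Y (fire E (A \<union> B) X)" "step\<^sup>=\<^sup>= Z (fire E (A \<union> B) X)"
    using one[of X A B] one[of X B A] by (simp_all add: Un_commute)
  then show "\<exists>U. steps Y U \<and> step\<^sup>=\<^sup>= Z U" by auto
qed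

lemma steps_to_stable:
  assumes "steps X Y" "steps X Z" "stable E H Z"
  shows "steps Y Z"
proof -
  obtain U where "steps Y U" "steps Z U"
    using confluentpD[OF confluent_step assms(1,2)] by blast
  then show ?thesis using stable_steps[OF _ assms(3)] by auto
qed

text \<open>A ready set avoids the sink, so the added chips are nonnegative on it and keep it
  ready.\<close>

lemma step_add:
  assumes "step X Y" "configuration s c"
  shows "step (X + c) (Y + c)"
proof -
  obtain M where M: "ready E H X M" "Y = fire E M X"
    using assms(1) by (auto simp: step_def)
  then have "0 \<le> c $ v" if "v \<in> M" for v
    using that assms(2) sink_notin_ready[OF M(1)] by (cases "v = s") (simp_all add: configuration_def)
  then show ?thesis
    using M unfolding step_def ready_def by (intro exI[of _ M]) (auto simp: fire_add)
qed

lemma steps_add: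
  assumes "steps X Y" "configuration s c"
  shows "steps (X + c) (Y + c)"
  using assms(1)
proof induction
  case (step Y Z)
  then show ?case using step_add[OF _ assms(2)] by (meson rtranclp.rtrancl_into_rtrancl)
qed simp

text \<open>A vertex outside the fired set, in particular the sink, only gains chips, and a fired
  vertex ends without debt. The bound at the sink later confines every run to a finite set.\<close>

lemma step_configuration:
  assumes "step X Y" "configuration s X"
  shows "configuration s Y" "X $ s \<le> Y $ s"
proof -
  obtain M where M: "ready E H X M" "Y = fire E M X"
    using assms(1) by (auto simp: step_def)
  have "Y $ v \<ge> 0" if "v \<noteq> s" for v
    using M that assms(2) fire_nth_ge[of v M X E]
    by (cases "v \<in> M") (auto simp: ready_def configuration_def intro: order_trans)
  then show "configuration s Y"
    using M assms(2) degree_zero_diff_laplacian[OF loopless]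
    by (simp add: configuration_def fire_def)
  show "X $ s \<le> Y $ s"
    unfolding M(2) by (rule fire_nth_ge[OF sink_notin_ready[OF M(1)]])
qed

lemma steps_configuration:
  assumes "steps X Y" "configuration s X"
  shows "configuration s Y" "X $ s \<le> Y $ s"
proof -
  have "configuration s Y \<and> X $ s \<le> Y $ s"
    using assms(1) by induction (use assms(2) step_configuration in \<open>auto intro: order_trans\<close>)
  then show "configuration s Y" "X $ s \<le> Y $ s" by auto
qed

section \<open>Termination and existence of stabilizations\<close>

lemma steps_laplacian:
  assumes "steps X Y"
  shows "\<exists>x. Y = X - laplacian E *v x"
proof -
  have "(\<lambda>X Y. \<exists>S. Y = fire E S X)\<^sup>*\<^sup>* X Y"
    using assms by (rule rtranclp_mono[THEN predicate2D, rotated]) (auto simp: step_def)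
  then show ?thesis by (rule fires_imp_span)
qed

text \<open>The vector \<open>x\<close> counts how often each vertex fires along the run.\<close>

lemma tranclp_step_laplacian:
  assumes "step\<^sup>+\<^sup>+ X Y"
  shows "\<exists>x. Y = X - laplacian E *v x \<and> (\<forall>v. x $ v \<ge> 0) \<and> x $ s = 0 \<and> x \<noteq> 0"
proof -
  have one: "\<exists>x. Y = X - laplacian E *v x \<and> (\<forall>v. x $ v \<ge> 0) \<and> x $ s = 0 \<and> x \<noteq> 0"
    if XY: "step X Y" for X Y
  proof -
    obtain M where M: "ready E H X M" "Y = fire E M X"
      using XY by (auto simp: step_def)
    then have "char_vec M $ s = 0" "char_vec M \<noteq> 0"
      using sink_notin_ready by (auto simp: char_vec_def ready_def vec_eq_iff)
    then show ?thesis
      using M by (intro exI[of _ "char_vec M"]) (auto simp: fire_def char_vec_def)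
  qed
  from assms show ?thesis
  proof (induction rule: tranclp_induct)
    case (base Y)
    then show ?case by (rule one)
  next
    case (step Y Z)
    obtain x where x: "Y = X - laplacian E *v x" "\<forall>v. x $ v \<ge> 0" "x $ s = 0" "x \<noteq> 0"
      using step.IH by blast
    obtain y where y: "Z = Y - laplacian E *v y" "\<forall>v. y $ v \<ge> 0" "y $ s = 0"
      using one[OF step.hyps(2)] by blast
    obtain v where "x $ v \<noteq> 0" using x(4) by (auto simp: vec_eq_iff)
    \<comment> \<open>Firing counts are nonnegative, so they cannot cancel.\<close>
    then have "x $ v + y $ v > 0" using x(2) y(2) by (metis add_pos_nonneg order_le_less)
    then have "x + y \<noteq> 0" by (auto simp: vec_eq_iff intro!: exI[of _ v])
    then show ?case
      using x y by (intro exI[of _ "x + y"]) (simp add: matrix_vector_right_distrib)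
  qed
qed

lemma step_acyclic: "\<not> step\<^sup>+\<^sup>+ X X"
proof
  assume "step\<^sup>+\<^sup>+ X X"
  then obtain x where "X = X - laplacian E *v x" "\<forall>v. x $ v \<ge> 0" "x $ s = 0" "x \<noteq> 0"
    using tranclp_step_laplacian by blast
  then show False using laplacian_kernel_nonneg_eq_0[OF connected, of x s] by auto
qed

text \<open>By degree zero the entries off the sink are nonnegative with sum \<open>- X $ s\<close>,
  which is at most \<open>- b\<close>.\<close>

lemma finite_configurations_ge:
  "finite {X. configuration s X \<and> b \<le> X $ s}"
proof -
  define B where "B = \<bar>b\<bar>"
  have "X $ v \<in> {-B..B}" if X: "configuration s X" "b \<le> X $ s" for X v
  proof -
    have nonneg: "0 \<le> X $ u" if "u \<in> UNIV - {s}" for u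
      using X that by (simp add: configuration_def)
    have "X $ s + (\<Sum>u\<in>UNIV - {s}. X $ u) = (\<Sum>u\<in>UNIV. X $ u)"
      by (rule sum.remove[symmetric]) auto
    then have eq: "(\<Sum>u\<in>UNIV - {s}. X $ u) = - X $ s"
      using X by (simp add: configuration_def degree_zero_def)
    have "0 \<le> (\<Sum>u\<in>UNIV - {s}. X $ u)" by (rule sum_nonneg) (rule nonneg)
    then have "X $ s \<le> 0" using eq by simp
    moreover have "0 \<le> X $ v \<and> X $ v \<le> - X $ s" if "v \<noteq> s"
      unfolding eq[symmetric] using nonneg that by (auto intro!: member_le_sum)
    ultimately show ?thesis
      using X(2) unfolding B_def by (cases "v = s") force+
  qed
  then have "{X. configuration s X \<and> b \<le> X $ s} \<subseteq> vec_lambda ` (UNIV \<rightarrow>\<^sub>E {-B..B})"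
    by (auto simp: image_iff PiE_UNIV_domain intro!: bexI[of _ "vec_nth _"])
  then show ?thesis by (rule finite_subset) (intro finite_imageI finite_PiE, auto)
qed

text \<open>Only finitely many configurations can be reached from \<open>D\<close>, and firing is
  acyclic on them, so some reachable configuration has no successor.\<close>

lemma ex_stabilization:
  assumes "configuration s D"
  shows "\<exists>Z. steps D Z \<and> stable E H Z"
proof -
  let ?A = "{X. steps D X}"
  let ?r = "{(X, Y). X \<in> ?A \<and> step X Y}"
  have "?A \<subseteq> {X. configuration s X \<and> D $ s \<le> X $ s}"
    by (auto dest: steps_configuration[OF _ assms])
  then have "finite ?A" by (rule finite_subset) (rule finite_configurations_ge)
  then have "finite (?A \<times> ?A)" by simp
  moreover have "?r \<subseteq> ?A \<times> ?A" by (auto intro: rtranclp.rtrancl_into_rtrancl)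
  ultimately have "finite ?r" by (rule finite_subset[rotated])
  moreover have "acyclic ?r"
  proof (rule acyclicI, intro allI notI)
    fix X assume "(X, X) \<in> ?r\<^sup>+"
    moreover have "step\<^sup>+\<^sup>+ X Y" if "(X, Y) \<in> ?r\<^sup>+" for Y
      using that by induction (auto intro: tranclp.trancl_into_trancl)
    ultimately show False using step_acyclic by blast
  qed
  ultimately have "wf (?r\<inverse>)" by (rule finite_acyclic_wf_converse)
  then obtain Z where Z: "Z \<in> ?A" "\<And>Y. (Y, Z) \<in> ?r\<inverse> \<Longrightarrow> Y \<notin> ?A"
    using wfE_min[of "?r\<inverse>" D ?A] by blast
  then have "stable E H Z"
    unfolding stable_iff by (auto dest: rtranclp.rtrancl_into_rtrancl[of step D Z])
  then show ?thesis using Z by blast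
qed

section \<open>Firing single vertices\<close>

lemma stable_less_degree:
  assumes "stable E H Z" "v \<noteq> s"
  shows "Z $ v < int (vertex_degree E v)"
proof -
  have "\<not> ready E H Z {v}" using assms(1) by (simp add: stable_def)
  then show ?thesis
    using singleton_in_H[OF assms(2)] by (simp add: ready_def fire_nth)
qed

text \<open>Vertices are fired one at a time, which every hereditary model allows because it
  contains the singletons. Each vertex starts with enough chips for all its own firings, so the
  order is irrelevant.\<close>

lemma steps_fire_vector:
  assumes "configuration s X" "\<And>v. x $ v \<ge> 0" "x $ s = 0"
    and "\<And>v. v \<noteq> s \<Longrightarrow> int (vertex_degree E v) * x $ v \<le> X $ v"
  shows "steps X (X - laplacian E *v x)"
  using assms
proof (induction "nat (\<Sum>v\<in>UNIV. x $ v)" arbitrary: X x rule: less_induct)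
  case less
  show ?case
  proof (cases "x = 0")
    case True
    then show ?thesis by simp
  next
    case False
    then obtain v where v0: "x $ v \<noteq> 0" by (auto simp: vec_eq_iff)
    with less.prems have v: "x $ v \<ge> 1" "v \<noteq> s"
      by (auto simp: order.strict_iff_order zless_imp_add1_zle int_one_le_iff_zero_less)
    let ?y = "x - char_vec {v}" and ?Y = "fire E {v} X"
    have y: "?y $ u = (if u = v then x $ v - 1 else x $ u)" for u
      by (simp add: char_vec_def)
    have deg: "int (vertex_degree E v) \<le> X $ v"
      using less.prems(4)[OF v(2)] v(1)
      by (metis mult.right_neutral mult_left_mono of_nat_0_le_iff order_trans)
    have "step X ?Y"
      unfolding step_def ready_def using deg singleton_in_H[OF v(2)]
      by (intro exI[of _ "{v}"]) (simp add: fire_nth)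
    moreover have "steps ?Y (?Y - laplacian E *v ?y)"
    proof (rule less.hyps)
      have "(\<Sum>u\<in>UNIV. ?y $ u) < (\<Sum>u\<in>UNIV. x $ u)"
        unfolding y by (rule sum_strict_mono_ex1) auto
      moreover have "0 \<le> (\<Sum>u\<in>UNIV. ?y $ u)"
        unfolding y using v less.prems(2) by (intro sum_nonneg) simp
      ultimately show "nat (\<Sum>u\<in>UNIV. ?y $ u) < nat (\<Sum>u\<in>UNIV. x $ u)" by simp
      show "configuration s ?Y"
        using \<open>step X ?Y\<close> less.prems(1) step_configuration by blast
      show "?y $ u \<ge> 0" for u unfolding y using v less.prems(2) by simp
      show "?y $ s = 0" unfolding y using v less.prems(3) by simp
      \<comment> \<open>At \<open>v\<close> the requirement drops by the degree, which covers the
        loss of chips; other vertices only gain.\<close>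
      show "int (vertex_degree E u) * ?y $ u \<le> ?Y $ u" if "u \<noteq> s" for u
        using less.prems(4)[OF that]
        by (cases "u = v")
          (simp_all add: y[unfolded vector_minus_component] fire_nth right_diff_distrib)
    qed
    moreover have "?Y - laplacian E *v ?y = X - laplacian E *v x"
      by (simp add: fire_def matrix_vector_mult_diff_distrib)
    ultimately show ?thesis by (metis converse_rtranclp_into_rtranclp)
  qed
qed

section \<open>Recurrent configurations\<close>

text \<open>Global reachability says nothing about \<open>D = \<nu>\<close>; there no chips are
  added and nothing is fired.\<close>

lemma recurrent_reachable:
  assumes "recurrent E s H \<nu>" "configuration s D"
  shows "\<exists>c. configuration s c \<and> steps (D + c) \<nu>"
proof (cases "D = \<nu>")
  case True
  have "configuration s (0 :: int ^ 'v)" by (simp add: configuration_def degree_zero_def)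
  then show ?thesis using True by (intro exI[of _ 0]) simp
next
  case False
  then show ?thesis
    using assms by (auto simp: recurrent_def globally_reachable_def reachable_iff)
qed

lemma ex_large_recurrent_identity:
  assumes K: "configuration s K"
  shows "\<exists>e x. configuration s e \<and> (\<forall>v. v \<noteq> s \<longrightarrow> K $ v \<le> e $ v) \<and> e = laplacian E *v x \<and>
    (\<forall>\<nu>. recurrent E s H \<nu> \<longrightarrow> steps (\<nu> + e) \<nu>)"
proof -
  have "0 \<le> K $ v + int (vertex_degree E v)" if "v \<noteq> s" for v
    using K that by (simp add: configuration_def)
  \<comment> \<open>A stable \<open>z\<close> stays below the degree off the sink, so this margin
    ensures that \<open>d - z\<close> still dominates \<open>K\<close>.\<close>
  then obtain d where d: "configuration s d"
      "\<And>v. v \<noteq> s \<Longrightarrow> d $ v = K $ v + int (vertex_degree E v)"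
    using ex_configuration[of s "\<lambda>v. K $ v + int (vertex_degree E v)"] by blast
  obtain z where z: "steps d z" "stable E H z" using ex_stabilization[OF d(1)] by blast
  let ?e = "d - z"
  have ge: "K $ v \<le> ?e $ v" if "v \<noteq> s" for v
    using d(2)[OF that] stable_less_degree[OF z(2) that] by simp
  have e: "configuration s ?e"
  proof (rule configuration_diff[OF d(1) steps_configuration(1)[OF z(1) d(1)]])
    fix v assume "v \<noteq> s"
    then show "z $ v \<le> d $ v" using ge[of v] K by (force simp: configuration_def)
  qed
  have "steps (\<nu> + ?e) \<nu>" if \<nu>: "recurrent E s H \<nu>" for \<nu>
  proof -
    obtain c where c: "configuration s c" "steps (d + c) \<nu>"
      using recurrent_reachable[OF \<nu> d(1)] by blast
    \<comment> \<open>Firing \<open>d\<close> to \<open>z\<close> underneath \<open>c + ?e\<close>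
      absorbs \<open>?e\<close>, as \<open>z + ?e = d\<close>. The run then continues to
      \<open>\<nu>\<close>. Firing \<open>d + c\<close> to \<open>\<nu>\<close> underneath
      \<open>?e\<close> instead leads to \<open>\<nu> + ?e\<close>, and confluence joins the two
      runs.\<close>
    have "steps (d + (c + ?e)) (z + (c + ?e))"
      by (rule steps_add[OF z(1) configuration_add[OF c(1) e]])
    then have "steps (d + c + ?e) (d + c)" by (simp add: algebra_simps)
    then have "steps (d + c + ?e) \<nu>" using c(2) by auto
    moreover have "stable E H \<nu>" using \<nu> by (simp add: recurrent_def)
    ultimately show ?thesis by (rule steps_to_stable[OF steps_add[OF c(2) e]])
  qed
  moreover obtain x where "?e = laplacian E *v x"
    using steps_laplacian[OF z(1)] by auto
  ultimately show ?thesis using e ge by blast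
qed

lemma ex_recurrent_equiv:
  assumes "degree_zero D"
  shows "\<exists>\<nu>. (D, \<nu>) \<in> firing_equiv E \<and> recurrent E s H \<nu>"
proof -
  \<comment> \<open>The absolute value offsets possible debts of \<open>D\<close>; the degree makes
    \<open>D + e\<close> dominate every stable configuration off the sink.\<close>
  obtain K where K: "configuration s K"
      "\<And>v. v \<noteq> s \<Longrightarrow> K $ v = \<bar>D $ v\<bar> + int (vertex_degree E v)"
    using ex_configuration[of s "\<lambda>v. \<bar>D $ v\<bar> + int (vertex_degree E v)"] by auto
  obtain e x where e: "configuration s e" "\<And>v. v \<noteq> s \<Longrightarrow> K $ v \<le> e $ v" "e = laplacian E *v x"
    using ex_large_recurrent_identity[OF K(1)] by blast
  have ge: "int (vertex_degree E v) \<le> (D + e) $ v" if "v \<noteq> s" for v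
    using K(2)[OF that] e(2)[OF that] by simp
  have De: "configuration s (D + e)"
    unfolding configuration_def
  proof (intro conjI allI impI)
    show "degree_zero (D + e)"
      using assms e(1) by (simp add: configuration_def degree_zero_def sum.distrib)
    show "0 \<le> (D + e) $ v" if "v \<noteq> s" for v
      using ge[OF that] by (meson of_nat_0_le_iff order_trans)
  qed
  obtain \<nu> where \<nu>: "steps (D + e) \<nu>" "stable E H \<nu>" using ex_stabilization[OF De] by blast
  have conf: "configuration s \<nu>" by (rule steps_configuration(1)[OF \<nu>(1) De])
  have "reachable E s H D' \<nu>" if D': "configuration s D'" for D'
  proof -
    obtain z where z: "steps D' z" "stable E H z" using ex_stabilization[OF D'] by blast
    \<comment> \<open>These chips, added to \<open>D'\<close>, turn its stabilization
      \<open>z\<close> into \<open>D + e\<close>, which fires on to \<open>\<nu>\<close>.\<close>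
    have c: "configuration s (D + e - z)"
    proof (rule configuration_diff[OF De steps_configuration(1)[OF z(1) D']])
      show "z $ v \<le> (D + e) $ v" if "v \<noteq> s" for v
        using ge[OF that] stable_less_degree[OF z(2) that] by linarith
    qed
    have "steps (D' + (D + e - z)) (D + e)"
      using steps_add[OF z(1) c] by simp
    then have "steps (D' + (D + e - z)) \<nu>" using \<nu>(1) by (rule rtranclp_trans)
    then show ?thesis using c by (auto simp: reachable_iff)
  qed
  then have "recurrent E s H \<nu>"
    using conf \<nu>(2) by (simp add: recurrent_def globally_reachable_def)
  moreover obtain y where "\<nu> = D + e - laplacian E *v y"
    using steps_laplacian[OF \<nu>(1)] by blast
  then have "D - \<nu> = laplacian E *v (y - x)"
    using e(3) by (simp add: matrix_vector_mult_diff_distrib)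
  then have "(D, \<nu>) \<in> firing_equiv E"
    using assms conf by (auto simp: firing_equiv_iff_span[OF loopless] configuration_def)
  ultimately show ?thesis by blast
qed

lemma recurrent_equiv_imp_eq:
  assumes \<nu>: "recurrent E s H \<nu>" and \<nu>': "recurrent E s H \<nu>'"
    and equiv: "(\<nu>, \<nu>') \<in> firing_equiv E"
  shows "\<nu> = \<nu>'"
proof -
  obtain g where g: "\<nu> - \<nu>' = laplacian E *v g"
    using equiv by (auto simp: firing_equiv_iff_span[OF loopless])
  \<comment> \<open>Constant vectors lie in the kernel of the Laplacian, so the firing vector can be
    normalized to leave the sink unfired.\<close>
  define f where "f = g - g $ s *s char_vec UNIV"
  have "laplacian E *v (g $ s *s char_vec UNIV) = g $ s *s (laplacian E *v char_vec UNIV)"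
    by (simp add: vec_eq_iff matrix_vector_mult_def sum_distrib_left mult_ac)
  then have f: "\<nu> - \<nu>' = laplacian E *v f"
    by (simp add: f_def g matrix_vector_mult_diff_distrib laplacian_char_vec_UNIV[OF loopless])
  have fs: "f $ s = 0" by (simp add: f_def char_vec_def)
  \<comment> \<open>The positive and negative parts of \<open>f\<close> are firing vectors that lead
    from \<open>\<nu>\<close> and \<open>\<nu>'\<close> to the same vector, possibly through
    debt.\<close>
  define p where "p = (\<chi> v. max 0 (f $ v))"
  define q where "q = (\<chi> v. max 0 (- f $ v))"
  have "f = p - q" by (auto simp: vec_eq_iff p_def q_def)
  then have common: "\<nu> - laplacian E *v p = \<nu>' - laplacian E *v q"
    using f by (simp add: matrix_vector_mult_diff_distrib) (simp add: algebra_simps)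
  \<comment> \<open>Both \<open>p\<close> and \<open>q\<close> are bounded by the absolute value of
    \<open>f\<close>, so chips in this amount make both firings legal.\<close>
  obtain K where K: "configuration s K"
      "\<And>v. v \<noteq> s \<Longrightarrow> K $ v = int (vertex_degree E v) * \<bar>f $ v\<bar>"
    using ex_configuration[of s "\<lambda>v. int (vertex_degree E v) * \<bar>f $ v\<bar>"] by auto
  obtain e where e: "configuration s e" "\<And>v. v \<noteq> s \<Longrightarrow> K $ v \<le> e $ v"
      "\<And>\<nu>. recurrent E s H \<nu> \<Longrightarrow> steps (\<nu> + e) \<nu>"
    using ex_large_recurrent_identity[OF K(1)] by blast
  have legal: "steps (\<mu> + e) (\<mu> + e - laplacian E *v x)"
    if \<mu>: "recurrent E s H \<mu>" and x: "\<And>v. 0 \<le> x $ v" "x $ s = 0" "\<And>v. x $ v \<le> \<bar>f $ v\<bar>" for \<mu> x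
  proof (rule steps_fire_vector)
    show "configuration s (\<mu> + e)" using \<mu> configuration_add[OF _ e(1)] by (simp add: recurrent_def)
    show "int (vertex_degree E v) * x $ v \<le> (\<mu> + e) $ v" if "v \<noteq> s" for v
    proof -
      have "int (vertex_degree E v) * x $ v \<le> int (vertex_degree E v) * \<bar>f $ v\<bar>"
        by (rule mult_left_mono) (use x in auto)
      also have "\<dots> \<le> e $ v" using e(2)[OF that] K(2)[OF that] by simp
      also have "\<dots> \<le> (\<mu> + e) $ v" using \<mu> that by (simp add: recurrent_def configuration_def)
      finally show ?thesis .
    qed
  qed (use x in auto)
  let ?W = "\<nu> + e - laplacian E *v p"
  have W': "?W = \<nu>' + e - laplacian E *v q" using common by (simp add: algebra_simps)
  have stable: "stable E H \<nu>" "stable E H \<nu>'"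
    using \<nu> \<nu>' by (simp_all add: recurrent_def)
  \<comment> \<open>Since \<open>\<nu> + e\<close> also fires to the stable \<open>\<nu>\<close>,
    confluence carries \<open>?W\<close> to \<open>\<nu>\<close>; likewise it carries
    \<open>?W\<close> to \<open>\<nu>'\<close>.\<close>
  have "steps (\<nu> + e) ?W" using fs by (intro legal[OF \<nu>]) (auto simp: p_def)
  then have "steps ?W \<nu>" by (rule steps_to_stable[OF _ e(3)[OF \<nu>] stable(1)])
  moreover have "steps (\<nu>' + e) ?W" unfolding W' using fs by (intro legal[OF \<nu>']) (auto simp: q_def)
  then have "steps ?W \<nu>'" by (rule steps_to_stable[OF _ e(3)[OF \<nu>'] stable(2)])
  ultimately have "steps \<nu> \<nu>'" by (rule steps_to_stable[OF _ _ stable(2)])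
  then show ?thesis by (rule stable_steps[OF _ stable(1), symmetric])
qed

end

theorem theorem1:
  fixes E :: "'v::finite set multiset" and s :: 'v and H :: "'v set set"
  assumes "loopless_multigraph E" and "connected_multigraph E"
    and "hereditary_model s H"
  shows "\<forall>C\<in>firing_classes E. \<exists>!\<nu>. \<nu> \<in> C \<and> recurrent E s H \<nu>"
proof
  interpret hereditary_chip_firing E s H
    using assms by unfold_locales
  note equiv = equiv_firing_equiv[OF assms(1)]
  fix C assume "C \<in> firing_classes E"
  then have C: "C \<in> {D. degree_zero D} // firing_equiv E"
    by (simp add: firing_classes_def)
  then obtain D where D: "degree_zero D" "C = firing_equiv E `` {D}"
    by (auto elim: quotientE)
  show "\<exists>!\<nu>. \<nu> \<in> C \<and> recurrent E s H \<nu>"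
  proof (rule ex_ex1I)
    show "\<exists>\<nu>. \<nu> \<in> C \<and> recurrent E s H \<nu>"
      using ex_recurrent_equiv[OF D(1)] D(2) by auto
    show "\<nu> = \<nu>'" if "\<nu> \<in> C \<and> recurrent E s H \<nu>" "\<nu>' \<in> C \<and> recurrent E s H \<nu>'" for \<nu> \<nu>'
      using that quotient_eq_iff[OF equiv C C] recurrent_equiv_imp_eq by blast
  qed
qed

end
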